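(* There is a constant $c>0$ such that the following holds. Let $\varepsilon\in(0,\frac1{16})$, let $n\ge 1/\varepsilon^2$ be an integer, and let $d\geq 1$ be an integer. Let $(V_n,\rho_n)$ be the $n$-node star metric. Suppose there exists a $1$-Lipschitz mapping $f:V_n\to\ell_1^d$ such that $\|f(x)-f(y)\|_1\ge(1-\varepsilon)\rho_n(x,y)$ for all $x,y\in V_n$. Then $$d\ge\frac{c\log n}{\varepsilon^2\log(1/\varepsilon)}.$$
   Context: The $n$-node star is the simple undirected graph $G_n=(V_n,E_n)$ with $|V_n|=n$ in which one node has degree $n-1$ and all other nodes have degree one. $\rho_n$ denotes the shortest-path metric on $V_n$, where each edge has unit length. $\ell_1^d$ denotes $\mathbb R^d$ equipped with the $\ell_1$ norm. $f$ is $1$-Lipschitz if $\|f(x)-f(y)\|_1\le\rho_n(x,y)$ for all $x,y\in V_n$. *)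

theory Defs
  imports
    "HOL-Analysis.Analysis"
    "Graph_Theory.Graph_Theory"
    "Jordan_Normal_Form.Matrix"
begin

text \<open>
  In a \<^const>\<open>pair_graph\<close> an undirected edge is a pair of opposite arcs, so the degree of a
  vertex is its out-degree.
\<close>

definition star_graph :: "nat \<Rightarrow> 'a pair_pre_digraph \<Rightarrow> bool" where
  "star_graph n G \<longleftrightarrow> pair_graph G \<and> card (pverts G) = n \<and>
     (\<exists>r\<in>pverts G. out_degree (with_proj G) r = n - 1 \<and>
        (\<forall>v\<in>pverts G - {r}. out_degree (with_proj G) v = 1))"

text \<open>
  The library's shortest-path length is an extended real, infinite between different components.
  A star is connected, so the conversion to a real loses nothing there.
\<close>

definition graph_dist :: "'a pair_pre_digraph \<Rightarrow> 'a \<Rightarrow> 'a \<Rightarrow> real" where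
  "graph_dist G x y = real_of_ereal (wf_digraph.\<mu> (with_proj G) (\<lambda>_. 1) x y)"

definition l1_norm :: "real vec \<Rightarrow> real" where
  "l1_norm v = (\<Sum>i<dim_vec v. \<bar>v $ i\<bar>)"

definition one_lipschitz :: "'a pair_pre_digraph \<Rightarrow> ('a \<Rightarrow> real vec) \<Rightarrow> bool" where
  "one_lipschitz G f \<longleftrightarrow>
     (\<forall>x\<in>pverts G. \<forall>y\<in>pverts G. l1_norm (f x - f y) \<le> graph_dist G x y)"

end

theory Submission
  imports Defs
begin

text \<open>
  Translate the embedding so that the centre of the star goes to the origin. The leaves become
  vectors of norm between \<open>1 - \<epsilon>\<close> and \<open>1\<close> at pairwise distance at least \<open>2 - 2\<epsilon>\<close>. After
  replacing each coordinate by its positive and its negative part they are nonnegative vectors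
  \<open>x\<^sub>i\<close> in dimension \<open>D = 2d\<close>, and the distance bound forces any two of them to
  overlap little: \<open>\<Sum>\<^sub>k min (x\<^sub>i\<^sub>k, x\<^sub>j\<^sub>k) \<le> \<epsilon>\<close>.

  Such a family is counted by discretising at the scale \<open>\<tau> = 1 / (4 \<epsilon> D)\<close>. Suppose that the
  integer vector \<open>(\<lfloor>x\<^sub>i\<^sub>k / \<tau>\<rfloor>)\<^sub>k\<close> has total at least \<open>M\<close>, the least integer with \<open>\<tau> M > \<epsilon>\<close>.
  Decrease it to an integer vector of total exactly \<open>M\<close>. Two indices cannot
  lead to the same integer vector, since the overlap would then be at least \<open>\<tau> M > \<epsilon>\<close>. So there
  are at most \<open>(M + D - 1) choose M\<close> such indices (\<open>card_small_overlap_le_choose\<close>). Here \<open>M\<close> is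
  about \<open>4 \<epsilon>\<^sup>2 D\<close>, so \<open>D / M\<close> is about \<open>1 / (4 \<epsilon>\<^sup>2)\<close>, and the logarithm of the binomial
  coefficient is of order \<open>\<epsilon>\<^sup>2 D ln (1 / \<epsilon>)\<close>.

  The total falls short of \<open>M\<close> only for an index whose vector keeps mass at least \<open>3/4\<close> when its
  entries are truncated at \<open>\<tau>\<close>. Distinct truncated vectors have inner products at most
  \<open>\<tau> \<epsilon> = 1 / (4 D)\<close>, whereas vectors of mass at least \<open>3/4\<close> on \<open>D\<close> coordinates have an average inner product of at least
  \<open>(3/4)\<^sup>2 / D\<close>. Hence the diagonal terms, which are at most \<open>\<tau>\<close>, have to compensate, and this
  is possible only for \<open>O(1 / \<epsilon>)\<close> indices (\<open>card_small_entry_mass\<close>). As \<open>n \<ge> 1 / \<epsilon>\<^sup>2\<close>, these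
  are a minority.
\<close>

section \<open>Families of nonnegative vectors with small overlap\<close>

lemma exists_smaller_nat_fun_with_sum:
  fixes u :: "nat \<Rightarrow> nat"
  assumes "M \<le> (\<Sum>k<D. u k)"
  shows "\<exists>w. (\<forall>k. w k \<le> u k) \<and> (\<Sum>k<D. w k) = M"
  using assms
proof (induction M)
  case 0
  show ?case by (intro exI[of _ "\<lambda>_. 0"]) auto
next
  case (Suc M)
  then obtain w where w: "\<And>k. w k \<le> u k" "(\<Sum>k<D. w k) = M" by auto
  have "\<exists>k<D. w k < u k"
  proof (rule ccontr)
    assume "\<not> ?thesis"
    hence "(\<Sum>k<D. u k) \<le> (\<Sum>k<D. w k)" by (intro sum_mono) (metis lessThan_iff not_less)
    thus False using Suc.prems w by simp
  qed
  then obtain k where k: "k < D" "w k < u k" by blast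
  have "(\<Sum>j<D. (w(k := Suc (w k))) j) = (\<Sum>j<D. w j + (if j = k then 1 else 0))"
    by (intro sum.cong) auto
  also have "\<dots> = Suc M" using k w by (simp add: sum.distrib)
  finally show ?case
    using w k by (intro exI[of _ "w(k := Suc (w k))"]) auto
qed

text \<open>
  A nonnegative integer vector of total \<open>M\<close> that lies below \<open>x\<^sub>i / \<tau>\<close> determines \<open>i\<close>, because a
  common lower bound \<open>\<tau> w\<close> of two members of the family bounds their overlap from below.
\<close>

lemma card_small_overlap_le_choose:
  fixes x :: "'i \<Rightarrow> nat \<Rightarrow> real" and \<epsilon> \<tau> :: real
  assumes \<tau>: "\<tau> > 0" and nonneg: "\<And>i k. x i k \<ge> 0"
    and overlap: "\<And>i j. i \<in> I \<Longrightarrow> j \<in> I \<Longrightarrow> i \<noteq> j \<Longrightarrow> (\<Sum>k<D. min (x i k) (x j k)) \<le> \<epsilon>"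
    and M: "\<epsilon> < \<tau> * real M"
    and large: "\<And>i. i \<in> I \<Longrightarrow> M \<le> (\<Sum>k<D. nat \<lfloor>x i k / \<tau>\<rfloor>)"
  shows "card I \<le> (M + D - 1) choose M"
proof -
  have "\<forall>i\<in>I. \<exists>w. (\<forall>k. w k \<le> nat \<lfloor>x i k / \<tau>\<rfloor>) \<and> (\<Sum>k<D. w k) = M"
    using exists_smaller_nat_fun_with_sum[OF large] by auto
  then obtain w where w_le: "\<And>i k. i \<in> I \<Longrightarrow> w i k \<le> nat \<lfloor>x i k / \<tau>\<rfloor>"
    and w_sum: "\<And>i. i \<in> I \<Longrightarrow> (\<Sum>k<D. w i k) = M"
    by metis
  have below: "\<tau> * real (w i k) \<le> x i k" if "i \<in> I" for i k
  proof -
    have "real (w i k) \<le> real (nat \<lfloor>x i k / \<tau>\<rfloor>)" using w_le[OF that] by simp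
    also have "\<dots> \<le> x i k / \<tau>" using nonneg \<tau> by simp
    finally show ?thesis using \<tau> by (simp add: field_simps)
  qed
  let ?s = "\<lambda>i. map (w i) [0..<D]"
  have "inj_on ?s I"
  proof (rule inj_onI, rule ccontr)
    fix i j assume ij: "i \<in> I" "j \<in> I" "?s i = ?s j" "i \<noteq> j"
    have eq: "w i k = w j k" if "k < D" for k
      using arg_cong[OF ij(3), of "\<lambda>l. l ! k"] that by simp
    have "\<tau> * real M = (\<Sum>k<D. \<tau> * real (w i k))"
      using w_sum[OF ij(1)] by (simp flip: sum_distrib_left of_nat_sum)
    also have "\<dots> \<le> (\<Sum>k<D. min (x i k) (x j k))"
      using below[OF ij(1)] below[OF ij(2)] eq by (intro sum_mono) (metis lessThan_iff min.bounded_iff)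
    also have "\<dots> \<le> \<epsilon>" using overlap ij by blast
    finally show False using M by simp
  qed
  hence "card I = card (?s ` I)" by (simp add: card_image)
  also have "\<dots> \<le> card {l::nat list. length l = D \<and> sum_list l = M}"
  proof (rule card_mono)
    have "{l::nat list. length l = D \<and> sum_list l = M} \<subseteq> {l. set l \<subseteq> {..M} \<and> length l = D}"
      by (auto dest: member_le_sum_list)
    thus "finite {l::nat list. length l = D \<and> sum_list l = M}"
      by (rule finite_subset) (simp add: finite_lists_length_eq)
    show "?s ` I \<subseteq> {l. length l = D \<and> sum_list l = M}"
      using w_sum by (auto simp: interv_sum_list_conv_sum_set_nat atLeast0LessThan)
  qed
  also have "\<dots> = (M + D - 1) choose M" by (rule card_length_sum_list)
  finally show ?thesis .
qed

text \<open>
  This bounds the number of vectors whose entries, cut off at \<open>\<tau>\<close>, still have mass \<open>\<alpha>\<close>. It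
  compares two bounds for the squared Euclidean norm of the sum of the truncated vectors. The norm
  is large by Cauchy-Schwarz, since the sum has mass \<open>\<alpha> card I\<close> on \<open>D\<close> coordinates. It is small
  because \<open>min a \<tau> * min b \<tau> \<le> \<tau> * min a b\<close> turns inner products into overlaps.
\<close>

lemma card_small_entry_mass:
  fixes x :: "'i \<Rightarrow> nat \<Rightarrow> real" and \<epsilon> \<tau> \<alpha> :: real
  assumes fin: "finite I" and \<tau>: "\<tau> > 0" and \<epsilon>: "\<epsilon> \<ge> 0" and \<alpha>: "\<alpha> \<ge> 0"
    and nonneg: "\<And>i k. x i k \<ge> 0"
    and mass: "\<And>i. i \<in> I \<Longrightarrow> (\<Sum>k<D. x i k) \<le> 1"
    and overlap: "\<And>i j. i \<in> I \<Longrightarrow> j \<in> I \<Longrightarrow> i \<noteq> j \<Longrightarrow> (\<Sum>k<D. min (x i k) (x j k)) \<le> \<epsilon>"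
    and small: "\<And>i. i \<in> I \<Longrightarrow> \<alpha> \<le> (\<Sum>k<D. min (x i k) \<tau>)"
  shows "\<alpha>\<^sup>2 * card I \<le> D * \<tau> * (1 + \<epsilon> * card I)"
proof (cases "I = {}")
  case True
  thus ?thesis using \<tau> by simp
next
  case False
  define y where "y i k = min (x i k) \<tau>" for i k
  have y: "0 \<le> y i k" "y i k \<le> \<tau>" "y i k \<le> x i k" for i k
    using nonneg \<tau> by (auto simp: y_def less_imp_le)
  have inner: "(\<Sum>k<D. y i k * y j k) \<le> \<tau> * (\<epsilon> + (if i = j then 1 else 0))"
    if "i \<in> I" "j \<in> I" for i j
  proof -
    have "y i k * y j k \<le> \<tau> * min (x i k) (x j k)" for k
    proof (cases "x i k \<le> x j k")
      case True
      have "y i k * y j k \<le> x i k * \<tau>" using y nonneg by (intro mult_mono) auto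
      thus ?thesis using True by (simp add: mult.commute)
    next
      case False
      have "y i k * y j k \<le> \<tau> * x j k" using y nonneg \<tau> by (intro mult_mono) auto
      thus ?thesis using False by simp
    qed
    hence "(\<Sum>k<D. y i k * y j k) \<le> \<tau> * (\<Sum>k<D. min (x i k) (x j k))"
      by (simp add: sum_distrib_left sum_mono)
    also have "(\<Sum>k<D. min (x i k) (x j k)) \<le> \<epsilon> + (if i = j then 1 else 0)"
      using overlap[OF that] mass[OF that(1)] \<epsilon> by (cases "i = j") auto
    finally show ?thesis using \<tau> by simp
  qed
  have "\<alpha> * card I \<le> (\<Sum>i\<in>I. \<Sum>k<D. y i k)"
    using sum_bounded_below[of I \<alpha> "\<lambda>i. \<Sum>k<D. y i k"] small by (simp add: y_def mult.commute)
  hence "(\<alpha> * card I)\<^sup>2 \<le> (\<Sum>i\<in>I. \<Sum>k<D. y i k)\<^sup>2"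
    using \<alpha> by (intro power_mono) auto
  also have "\<dots> = (\<Sum>k<D. 1 * (\<Sum>i\<in>I. y i k))\<^sup>2"
    by (subst sum.swap) simp
  also have "\<dots> \<le> D * (\<Sum>k<D. (\<Sum>i\<in>I. y i k)\<^sup>2)"
    using Cauchy_Schwarz_ineq_sum[of "\<lambda>_. 1" "\<lambda>k. \<Sum>i\<in>I. y i k" "{..<D}"] by simp
  also have "(\<Sum>k<D. (\<Sum>i\<in>I. y i k)\<^sup>2) = (\<Sum>k<D. \<Sum>i\<in>I. \<Sum>j\<in>I. y i k * y j k)"
    by (simp add: power2_eq_square sum_product)
  also have "\<dots> = (\<Sum>i\<in>I. \<Sum>j\<in>I. \<Sum>k<D. y i k * y j k)"
    by (subst sum.swap, rule sum.cong[OF refl], rule sum.swap)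
  also have "real D * \<dots> \<le> D * (\<Sum>i\<in>I. \<Sum>j\<in>I. \<tau> * (\<epsilon> + (if i = j then 1 else 0)))"
    by (intro mult_left_mono sum_mono inner) auto
  also have "(\<Sum>i\<in>I. \<Sum>j\<in>I. \<tau> * (\<epsilon> + (if i = j then 1 else 0))) = card I * (\<tau> * (1 + \<epsilon> * card I))"
    using fin by (simp add: sum.distrib flip: sum_distrib_left)
  finally have "card I * (\<alpha>\<^sup>2 * card I) \<le> card I * (D * \<tau> * (1 + \<epsilon> * card I))"
    by (simp add: algebra_simps power2_eq_square)
  moreover have "real (card I) > 0" using False fin by (simp add: card_gt_0_iff)
  ultimately show ?thesis by simp
qed

section \<open>The dimension bound for such families\<close>

text \<open>
  This is the usual estimate \<open>N choose M \<le> (e N / M) ^ M\<close>, which comes from the single term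
  \<open>M ^ M / fact M\<close> of the exponential series at \<open>M\<close>.
\<close>

lemma choose_le_exp_power:
  assumes "M > 0"
  shows "real ((M + D - 1) choose M) \<le> (exp 1 * (1 + D / M)) ^ M"
proof -
  have fact_bound: "real M ^ M / fact M \<le> exp 1 ^ M"
  proof -
    have "real M ^ M / fact M \<le> exp (real M)"
      using sum_le_suminf[OF summable_exp_generic[of "real M"], of "{M}"]
      by (simp add: exp_def divide_inverse mult.commute)
    thus ?thesis by (simp flip: exp_of_nat_mult)
  qed
  have "real ((M + D - 1) choose M) * fact M \<le> real ((M + D - 1) ^ M)"
    using binomial_fact_pow[of "M + D - 1" M] by (metis of_nat_fact of_nat_le_iff of_nat_mult)
  also have "\<dots> \<le> (real M * (1 + D / M)) ^ M"
    using assms by (simp add: algebra_simps power_mono)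
  also have "\<dots> = (real M ^ M / fact M) * (1 + D / M) ^ M * fact M"
    by (simp add: power_mult_distrib)
  finally have "real ((M + D - 1) choose M) \<le> (real M ^ M / fact M) * (1 + D / M) ^ M"
    by (simp only: mult_le_cancel_right_pos fact_gt_zero)
  also have "\<dots> \<le> exp 1 ^ M * (1 + D / M) ^ M"
    using fact_bound by (intro mult_right_mono) auto
  finally show ?thesis by (simp add: power_mult_distrib)
qed

text \<open>
  The scale \<open>\<tau> = 1 / (4 \<epsilon> D)\<close> balances the two counting lemmas: it is small enough for
  \<open>D \<tau> \<epsilon> = 1/4\<close> to stay below \<open>(3/4)\<^sup>2\<close>, so that only \<open>O(1 / \<epsilon>)\<close> vectors keep
  mass \<open>3/4\<close> after truncation, and large enough for the total \<open>M\<close> of the integer vectors to be only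
  of order \<open>\<epsilon>\<^sup>2 D\<close>.
\<close>

lemma almost_disjoint_vectors_dimension_bound:
  fixes x :: "'i \<Rightarrow> nat \<Rightarrow> real" and \<epsilon> :: real
  assumes fin: "finite I" and \<epsilon>: "0 < \<epsilon>" "\<epsilon> < 1 / 16"
    and n: "card I = n - 1" "real n \<ge> 1 / \<epsilon>\<^sup>2" and D: "D > 0"
    and nonneg: "\<And>i k. x i k \<ge> 0"
    and mass_le: "\<And>i. i \<in> I \<Longrightarrow> (\<Sum>k<D. x i k) \<le> 1"
    and mass_ge: "\<And>i. i \<in> I \<Longrightarrow> 1 - \<epsilon> \<le> (\<Sum>k<D. x i k)"
    and overlap: "\<And>i j. i \<in> I \<Longrightarrow> j \<in> I \<Longrightarrow> i \<noteq> j \<Longrightarrow> (\<Sum>k<D. min (x i k) (x j k)) \<le> \<epsilon>"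
  shows "ln (real n) \<le> 32 * \<epsilon>\<^sup>2 * D * ln (1 / \<epsilon>)"
proof -
  define \<tau> where "\<tau> = 1 / (4 * \<epsilon> * D)"
  have \<tau>: "\<tau> > 0" using \<epsilon> D by (simp add: \<tau>_def)
  define M where "M = nat \<lfloor>4 * \<epsilon>\<^sup>2 * D\<rfloor> + 1"
  have M_le: "real M \<le> 4 * \<epsilon>\<^sup>2 * D + 1" and M_gt: "4 * \<epsilon>\<^sup>2 * D < real M"
    using \<epsilon> by (simp_all add: M_def) linarith
  have M_iff: "M \<le> m \<longleftrightarrow> 4 * \<epsilon>\<^sup>2 * D < real m" for m :: nat
  proof -
    have "M \<le> m \<longleftrightarrow> nat \<lfloor>4 * \<epsilon>\<^sup>2 * D\<rfloor> < m" by (auto simp: M_def)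
    also have "\<dots> \<longleftrightarrow> \<lfloor>4 * \<epsilon>\<^sup>2 * D\<rfloor> < int m" using \<epsilon> by (simp add: nat_less_iff)
    also have "\<dots> \<longleftrightarrow> 4 * \<epsilon>\<^sup>2 * D < real m" by (simp add: floor_less_iff)
    finally show ?thesis .
  qed
  have e\<tau>: "\<epsilon> / \<tau> = 4 * \<epsilon>\<^sup>2 * D" by (simp add: \<tau>_def power2_eq_square)
  define B where "B = {i\<in>I. 3 / 4 \<le> (\<Sum>k<D. min (x i k) \<tau>)}"
  have "(3 / 4)\<^sup>2 * card B \<le> D * \<tau> * (1 + \<epsilon> * card B)"
    using \<epsilon> by (intro card_small_entry_mass[where x = x])
      (auto simp: B_def fin \<tau> nonneg mass_le overlap)
  also have "D * \<tau> = 1 / (4 * \<epsilon>)" using D by (simp add: \<tau>_def)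
  finally have B: "\<epsilon> * card B \<le> 4 / 5"
    using \<epsilon> by (simp add: field_simps power2_eq_square)
  have good: "card (I - B) \<le> (M + D - 1) choose M"
  proof (rule card_small_overlap_le_choose[where x = x and \<epsilon> = \<epsilon>, OF \<tau> nonneg])
    show "\<epsilon> < \<tau> * real M" using M_gt \<tau> unfolding e\<tau>[symmetric]
      by (simp add: pos_divide_less_eq mult.commute)
    show "(\<Sum>k<D. min (x i k) (x j k)) \<le> \<epsilon>" if "i \<in> I - B" "j \<in> I - B" "i \<noteq> j" for i j
      using overlap that by blast
    fix i assume i: "i \<in> I - B"
    have round: "x i k - min (x i k) \<tau> \<le> \<tau> * real (nat \<lfloor>x i k / \<tau>\<rfloor>)" for k
    proof (cases "x i k \<le> \<tau>")
      case True
      thus ?thesis using \<tau> by (simp add: min_def)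
    next
      case False
      have "x i k / \<tau> - 1 \<le> real (nat \<lfloor>x i k / \<tau>\<rfloor>)" by linarith
      thus ?thesis using False \<tau> by (simp add: min_def field_simps)
    qed
    \<comment> \<open>At most \<open>3/4\<close> of the mass is lost by rounding down, since rounding loses at most
      \<open>min (x i k) \<tau>\<close> in each coordinate.\<close>
    have "\<epsilon> < 1 - \<epsilon> - 3 / 4" using \<epsilon> by simp
    also have "\<dots> < (\<Sum>k<D. x i k - min (x i k) \<tau>)"
      using i mass_ge[of i] by (auto simp: B_def sum_subtractf not_le)
    also have "\<dots> \<le> (\<Sum>k<D. \<tau> * real (nat \<lfloor>x i k / \<tau>\<rfloor>))" by (intro sum_mono round)
    also have "\<dots> = \<tau> * real (\<Sum>k<D. nat \<lfloor>x i k / \<tau>\<rfloor>)" by (simp add: sum_distrib_left)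
    finally show "M \<le> (\<Sum>k<D. nat \<lfloor>x i k / \<tau>\<rfloor>)"
      unfolding M_iff e\<tau>[symmetric] using \<tau> by (simp add: field_simps)
  qed
  have "256 < 1 / \<epsilon>\<^sup>2"
  proof -
    have "\<epsilon>\<^sup>2 < (1 / 16)\<^sup>2" using \<epsilon> by (intro power_strict_mono) auto
    thus ?thesis using \<epsilon> by (simp add: field_simps power2_eq_square)
  qed
  hence n256: "real n > 256" using n by simp
  have cardB: "real (card B) \<le> real n / 4"
  proof -
    have "card B \<le> 4 / (5 * \<epsilon>)" using B \<epsilon> by (simp add: field_simps)
    also have "\<dots> \<le> (1 / \<epsilon>) * (1 / \<epsilon>) / 4"
      using \<epsilon> by (simp add: field_simps)
    also have "\<dots> \<le> real n / 4" using n by (simp add: power2_eq_square)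
    finally show ?thesis .
  qed
  have "card I = card B + card (I - B)"
    using fin by (subst card_Diff_subset) (auto simp: B_def card_mono)
  hence half: "real n / 2 \<le> real ((M + D - 1) choose M)"
    using cardB good n n256 by linarith
  \<comment> \<open>For \<open>M = 1\<close> the count is just \<open>D\<close>, too few for \<open>n \<ge> 1 / \<epsilon>\<^sup>2\<close> vectors. Excluding this case
    lets the rounding in \<open>M \<le> 4 \<epsilon>\<^sup>2 D + 1\<close> be absorbed into a factor of two.\<close>
  have one: "4 * \<epsilon>\<^sup>2 * D \<ge> 1"
  proof (rule ccontr)
    assume a: "\<not> ?thesis"
    hence "M = 1" using \<epsilon> by (simp add: M_def floor_eq_iff)
    hence "real n / 2 \<le> D" using half by simp
    moreover have "4 * real D < 1 / \<epsilon>\<^sup>2" using a \<epsilon> by (simp add: field_simps)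
    ultimately show False using n(2) n256 by linarith
  qed
  have "real n / 2 \<le> (exp 1 * (1 + D / M)) ^ M"
    by (rule order_trans[OF half choose_le_exp_power]) (simp add: M_def)
  also have "\<dots> \<le> (1 / \<epsilon>\<^sup>2) ^ M"
  proof (rule power_mono)
    have "real M > 0" using M_gt one by linarith
    hence "D / M \<le> 1 / \<epsilon>\<^sup>2 / 4" using M_gt \<epsilon> by (simp add: field_simps)
    hence "exp 1 * (1 + D / M) \<le> 3 * (1 + 1 / \<epsilon>\<^sup>2 / 4)"
      using exp_le by (intro mult_mono) auto
    also have "\<dots> = 3 + (3 / 4) * (1 / \<epsilon>\<^sup>2)" by simp
    also have "\<dots> \<le> 1 / \<epsilon>\<^sup>2" using \<open>256 < 1 / \<epsilon>\<^sup>2\<close> by linarith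
    finally show "exp 1 * (1 + D / M) \<le> 1 / \<epsilon>\<^sup>2" .
  qed simp
  finally have "ln (real n / 2) \<le> ln ((1 / \<epsilon>\<^sup>2) ^ M)" using n256 \<epsilon> by (subst ln_le_cancel_iff) auto
  also have "\<dots> = M * (2 * ln (1 / \<epsilon>))" using \<epsilon>
    by (simp add: ln_realpow ln_div)
  also have "\<dots> \<le> (8 * \<epsilon>\<^sup>2 * D) * (2 * ln (1 / \<epsilon>))"
    using M_le one \<epsilon> by (intro mult_right_mono) auto
  finally have "ln (real n / 2) \<le> 16 * \<epsilon>\<^sup>2 * D * ln (1 / \<epsilon>)" by simp
  moreover have "ln (real n) \<le> 2 * ln (real n / 2)"
  proof -
    have "ln (real n) \<le> ln ((real n / 2)\<^sup>2)"
      using n256 by (subst ln_le_cancel_iff) (auto simp: power2_eq_square field_simps)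
    thus ?thesis using n256 by (simp add: ln_realpow)
  qed
  ultimately show ?thesis by simp
qed

section \<open>Distances in a star\<close>

context pair_graph
begin

lemma awalk_cost_one: "awalk_cost (\<lambda>_. 1) p = real (length p)"
  by (induction p) auto

lemma graph_dist_eqI:
  assumes "awalk u p v" "length p = m" and "\<And>q. awalk u q v \<Longrightarrow> m \<le> length q"
  shows "graph_dist G u v = real m"
proof -
  have "\<mu> (\<lambda>_. 1) u v = ereal (real m)"
    unfolding \<mu>_def using assms
    by (intro antisym INF_lower2[of p] INF_greatest) (auto simp: awalk_cost_one)
  thus ?thesis by (simp add: graph_dist_def)
qed

end

text \<open>
  The degrees determine the arcs: without loops, out-degree \<open>n - 1\<close> forces arcs from the centre to
  all other vertices, and by symmetry the only arc out of a leaf is the one back to the centre.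
\<close>

lemma star_graph_distances:
  assumes "star_graph n G"
  obtains r where "r \<in> pverts G"
    and "\<And>v. v \<in> pverts G - {r} \<Longrightarrow> graph_dist G v r = 1"
    and "\<And>v w. v \<in> pverts G - {r} \<Longrightarrow> w \<in> pverts G - {r} \<Longrightarrow> v \<noteq> w \<Longrightarrow> graph_dist G v w = 2"
proof -
  from assms obtain r where G: "pair_graph G" and n: "card (pverts G) = n" and r: "r \<in> pverts G"
    and deg_r: "out_degree (with_proj G) r = n - 1"
    and deg: "\<And>v. v \<in> pverts G - {r} \<Longrightarrow> out_degree (with_proj G) v = 1"
    unfolding star_graph_def by blast
  interpret pair_graph G by (rule G)
  have out: "out_arcs (with_proj G) v = {e \<in> parcs G. fst e = v}" for v
    by (simp add: out_arcs_def)
  have "{e \<in> parcs G. fst e = r} = Pair r ` (pverts G - {r})"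
  proof (rule card_subset_eq)
    show "finite (Pair r ` (pverts G - {r}))" using pair_finite_verts by simp
    show "{e \<in> parcs G. fst e = r} \<subseteq> Pair r ` (pverts G - {r})"
      using pair_no_loops arc_snd_in_verts by force
    have "card (Pair r ` (pverts G - {r})) = n - 1"
      using r n by (subst card_image) (auto simp: inj_on_def)
    thus "card {e \<in> parcs G. fst e = r} = card (Pair r ` (pverts G - {r}))"
      using deg_r by (simp add: out_degree_def out)
  qed
  hence from_r: "(r, v) \<in> parcs G" if "v \<in> pverts G - {r}" for v
    using that by blast
  have to_r: "(v, r) \<in> parcs G" if "v \<in> pverts G - {r}" for v
    using from_r[OF that] pair_sym_arcs by (auto simp: symmetric_def elim: symE)
  have no_arc: "(v, w) \<notin> parcs G" if v: "v \<in> pverts G - {r}" and "w \<noteq> r" for v w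
  proof
    assume "(v, w) \<in> parcs G"
    hence "(v, w) \<in> {e \<in> parcs G. fst e = v}" "(v, r) \<in> {e \<in> parcs G. fst e = v}"
      using to_r[OF v] by auto
    moreover have "card {e \<in> parcs G. fst e = v} = 1"
      using deg[OF v] by (simp add: out_degree_def out)
    ultimately show False using \<open>w \<noteq> r\<close> by (metis card_1_singletonE prod.inject singletonD)
  qed
  show thesis
  proof
    show "r \<in> pverts G" by (rule r)
    fix v assume v: "v \<in> pverts G - {r}"
    have "graph_dist G v r = real 1"
    proof (rule graph_dist_eqI)
      show "awalk v [(v, r)] r" using to_r[OF v] v r by (simp add: awalk_simps)
      show "1 \<le> length q" if "awalk v q r" for q
        using that v by (cases q) (auto simp: awalk_Nil_iff)
    qed simp
    thus "graph_dist G v r = 1" by simp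
    fix w assume w: "w \<in> pverts G - {r}" and "v \<noteq> w"
    have "graph_dist G v w = real 2"
    proof (rule graph_dist_eqI)
      show "awalk v [(v, r), (r, w)] w"
        using to_r[OF v] from_r[OF w] v w r by (simp add: awalk_simps)
      show "2 \<le> length q" if q: "awalk v q w" for q
      proof (cases q)
        case Nil
        thus ?thesis using q \<open>v \<noteq> w\<close> by (auto simp: awalk_Nil_iff)
      next
        case (Cons e p)
        with q have e: "e \<in> parcs G" "fst e = v" "awalk (snd e) p w" by (auto simp: awalk_Cons_iff)
        have "p \<noteq> []"
        proof
          assume "p = []"
          with e have "e = (v, w)" by (auto simp: awalk_Nil_iff prod_eq_iff)
          with e no_arc[OF v, of w] w show False by auto
        qed
        thus ?thesis using Cons by (cases p) auto
      qed
    qed simp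
    thus "graph_dist G v w = 2" by simp
  qed
qed

section \<open>From signed to nonnegative vectors\<close>

definition signed_parts :: "nat \<Rightarrow> (nat \<Rightarrow> real) \<Rightarrow> nat \<Rightarrow> real" where
  "signed_parts d u k = (if k < d then max 0 (u k) else max 0 (- u (k - d)))"

lemma signed_parts_nonneg: "0 \<le> signed_parts d u k"
  by (simp add: signed_parts_def)

lemma sum_signed_blocks:
  fixes g :: "nat \<Rightarrow> real"
  shows "(\<Sum>k<2 * d. g k) = (\<Sum>k<d. g k + g (d + k))"
proof -
  have "(\<Sum>k<2 * d. g k) = (\<Sum>k<d. g k) + (\<Sum>k=d..<d + d. g k)"
    by (simp add: lessThan_atLeast0 sum.atLeastLessThan_concat mult_2)
  also have "(\<Sum>k=d..<d + d. g k) = (\<Sum>k<d. g (d + k))"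
    using sum.shift_bounds_nat_ivl[of g 0 d d] by (simp add: lessThan_atLeast0 add.commute)
  finally show ?thesis by (simp add: sum.distrib)
qed

lemma sum_signed_parts: "(\<Sum>k<2 * d. signed_parts d u k) = (\<Sum>k<d. \<bar>u k\<bar>)"
  unfolding sum_signed_blocks by (intro sum.cong) (auto simp: signed_parts_def)

text \<open>
  Coordinatewise this is \<open>\<bar>a - b\<bar> = \<bar>a\<bar> + \<bar>b\<bar> - 2 min \<bar>a\<bar> \<bar>b\<bar>\<close> for \<open>a\<close>, \<open>b\<close> of the same sign and
  \<open>\<bar>a - b\<bar> = \<bar>a\<bar> + \<bar>b\<bar>\<close> for opposite signs, where the supports of the parts are disjoint.
\<close>

lemma overlap_signed_parts:
  "2 * (\<Sum>k<2 * d. min (signed_parts d u k) (signed_parts d v k)) =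
     (\<Sum>k<d. \<bar>u k\<bar>) + (\<Sum>k<d. \<bar>v k\<bar>) - (\<Sum>k<d. \<bar>u k - v k\<bar>)"
  unfolding sum_signed_blocks sum_distrib_left sum.distrib[symmetric] sum_subtractf[symmetric]
  by (intro sum.cong) (auto simp: signed_parts_def min_def max_def abs_if)

section \<open>The lower bound for the star\<close>

theorem theorem1:
  shows "\<exists>c::real. c > 0 \<and>
    (\<forall>(\<epsilon>::real) (n::nat) (d::nat) (G::nat pair_pre_digraph).
       0 < \<epsilon> \<and> \<epsilon> < 1 / 16 \<and> real n \<ge> 1 / \<epsilon>\<^sup>2 \<and> d \<ge> 1 \<and> star_graph n G \<and>
       (\<exists>f \<in> pverts G \<rightarrow> carrier_vec d.
          one_lipschitz G f \<and>
          (\<forall>x\<in>pverts G. \<forall>y\<in>pverts G.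
             l1_norm (f x - f y) \<ge> (1 - \<epsilon>) * graph_dist G x y))
       \<longrightarrow> real d \<ge> c * ln (real n) / (\<epsilon>\<^sup>2 * ln (1 / \<epsilon>)))"
proof (intro exI[of _ "1 / 64"] conjI allI impI)
  show "(0::real) < 1 / 64" by simp
  fix \<epsilon> :: real and n d :: nat and G :: "nat pair_pre_digraph"
  assume "0 < \<epsilon> \<and> \<epsilon> < 1 / 16 \<and> real n \<ge> 1 / \<epsilon>\<^sup>2 \<and> d \<ge> 1 \<and> star_graph n G \<and>
       (\<exists>f \<in> pverts G \<rightarrow> carrier_vec d.
          one_lipschitz G f \<and>
          (\<forall>x\<in>pverts G. \<forall>y\<in>pverts G.
             l1_norm (f x - f y) \<ge> (1 - \<epsilon>) * graph_dist G x y))"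
  then obtain f where \<epsilon>: "0 < \<epsilon>" "\<epsilon> < 1 / 16" and n: "real n \<ge> 1 / \<epsilon>\<^sup>2" and d: "d \<ge> 1"
    and star: "star_graph n G" and f: "f \<in> pverts G \<rightarrow> carrier_vec d"
    and upper: "\<And>x y. x \<in> pverts G \<Longrightarrow> y \<in> pverts G \<Longrightarrow> l1_norm (f x - f y) \<le> graph_dist G x y"
    and lower: "\<And>x y. x \<in> pverts G \<Longrightarrow> y \<in> pverts G \<Longrightarrow>
      (1 - \<epsilon>) * graph_dist G x y \<le> l1_norm (f x - f y)"
    unfolding one_lipschitz_def by blast
  obtain r where r: "r \<in> pverts G"
    and to_r: "\<And>v. v \<in> pverts G - {r} \<Longrightarrow> graph_dist G v r = 1"
    and between: "\<And>v w. v \<in> pverts G - {r} \<Longrightarrow> w \<in> pverts G - {r} \<Longrightarrow> v \<noteq> w \<Longrightarrow> graph_dist G v w = 2"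
    using star_graph_distances[OF star] by blast
  have n_pos: "n > 0" and card: "card (pverts G) = n" and fin: "finite (pverts G)"
  proof -
    have "real n > 0" using n \<epsilon> by (smt (verit) zero_less_divide_1_iff zero_less_power)
    thus "n > 0" by simp
    moreover show "card (pverts G) = n" using star by (simp add: star_graph_def)
    ultimately show "finite (pverts G)" by (simp add: card_ge_0_finite)
  qed
  have l1: "l1_norm (f v - f w) = (\<Sum>k<d. \<bar>f v $ k - f w $ k\<bar>)"
    if "v \<in> pverts G" "w \<in> pverts G" for v w
  proof -
    have "f v \<in> carrier_vec d" "f w \<in> carrier_vec d" using f that by auto
    thus ?thesis unfolding l1_norm_def by (intro sum.cong) auto
  qed
  define u where "u v k = f v $ k - f r $ k" for v k
  have mass: "(\<Sum>k<d. \<bar>u v k\<bar>) \<le> 1" "1 - \<epsilon> \<le> (\<Sum>k<d. \<bar>u v k\<bar>)" if "v \<in> pverts G - {r}" for v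
    using upper[of v r] lower[of v r] to_r[OF that] l1[of v r] r that by (auto simp: u_def)
  have "ln (real n) \<le> 32 * \<epsilon>\<^sup>2 * real (2 * d) * ln (1 / \<epsilon>)"
  proof (rule almost_disjoint_vectors_dimension_bound[where I = "pverts G - {r}"
        and x = "\<lambda>v. signed_parts d (u v)", OF _ \<epsilon> _ n])
    show "card (pverts G - {r}) = n - 1" using card r fin by simp
    show "(\<Sum>k<2 * d. min (signed_parts d (u v) k) (signed_parts d (u w) k)) \<le> \<epsilon>"
      if "v \<in> pverts G - {r}" "w \<in> pverts G - {r}" "v \<noteq> w" for v w
    proof -
      have "2 * (1 - \<epsilon>) \<le> (\<Sum>k<d. \<bar>u v k - u w k\<bar>)"
        using lower[of v w] between[OF that] l1[of v w] that by (simp add: u_def)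
      hence "2 * (\<Sum>k<2 * d. min (signed_parts d (u v) k) (signed_parts d (u w) k))
          \<le> 1 + 1 - 2 * (1 - \<epsilon>)"
        unfolding overlap_signed_parts using mass(1)[OF that(1)] mass(1)[OF that(2)]
        by (intro diff_mono add_mono)
      thus ?thesis by simp
    qed
  qed (use d fin mass in \<open>auto simp: sum_signed_parts signed_parts_nonneg\<close>)
  moreover have "\<epsilon>\<^sup>2 * ln (1 / \<epsilon>) > 0" using \<epsilon> by simp
  ultimately show "1 / 64 * ln (real n) / (\<epsilon>\<^sup>2 * ln (1 / \<epsilon>)) \<le> real d"
    by (subst pos_divide_le_eq) (simp_all add: algebra_simps)
qed

end
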